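(* For integers $m\ge 2$ and $n\ge 1$ let $p_{m,n}$ be the number of rectangles on the square lattice of half-perimeter $m$ and area $n$, and let $\widetilde X_m$ be the random variable with $\mathbb P(\widetilde X_m=n)=p_{m,n}/\sum_{n}p_{m,n}$. Then $\widetilde X_m$ has mean $\mu_m\sim m^2/6$ and variance $\sigma_m^2\sim m^4/180$ as $m\to\infty$. The normalised random variables $X_m=4\widetilde X_m/m^2$ converge in distribution, as $m\to\infty$, to a continuous random variable $X$ with the beta law $\beta_{1,1/2}$, i.e. with probability density $p(x)=\frac{1}{2\sqrt{1-x}}$ for $0\le x<1$ and $p(x)=0$ otherwise. Moreover all moments converge: $\lim_{m\to\infty}\mathbb E[X_m^k]=\mathbb E[X^k]$ for every $k\in\mathbb N_0$.
   Context: Rectangles are axis-parallel rectangles with vertices in $\mathbb Z^2$ and positive integer side lengths, counted up to translation: a rectangle of width $l\ge1$ and height $h\ge 1$ has half-perimeter $l+h$ and area $lh$, and $(l,h)$, $(h,l)$ are distinct rectangles if $l\neq h$. Hence $p_{m,n}=\#\{l\in\{1,\dots,m-1\}: l(m-l)=n\}$. For sequences, $a_m\sim b_m$ means $a_m/b_m\to1$. *)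

theory Defs
  imports "HOL-Probability.Probability"
begin

text \<open>
  A lattice rectangle up to translation is encoded by its pair (width, height) of positive
  integers.
\<close>

definition rectangles :: "(nat \<times> nat) set" where
  "rectangles = {(l, h). l \<ge> 1 \<and> h \<ge> 1}"

definition half_perimeter :: "nat \<times> nat \<Rightarrow> nat" where
  "half_perimeter r = fst r + snd r"

definition area :: "nat \<times> nat \<Rightarrow> nat" where
  "area r = fst r * snd r"

definition rect_count :: "nat \<Rightarrow> nat \<Rightarrow> nat" where
  "rect_count m n = card {r \<in> rectangles. half_perimeter r = m \<and> area r = n}"

lemma rect_count_eq: "rect_count m n = card {l \<in> {1..m-1}. l * (m - l) = n}"
proof -
  have "bij_betw (\<lambda>l. (l, m - l)) {l \<in> {1..m-1}. l * (m - l) = n}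
          {r \<in> rectangles. half_perimeter r = m \<and> area r = n}"
    by (rule bij_betw_byWitness[where f' = fst])
       (auto simp: rectangles_def half_perimeter_def area_def)
  then show ?thesis
    unfolding rect_count_def by (simp add: bij_betw_same_card)
qed

lemma rect_count_infsum: "(\<Sum>\<^sub>\<infinity>n\<in>{1..}. real (rect_count m n)) = real (m - 1)"
proof -
  let ?f = "\<lambda>l. l * (m - l)"
  let ?T = "?f ` {1..m-1}"
  have pos: "?T \<subseteq> {1..}" by (auto simp: Suc_le_eq)
  have zero: "rect_count m n = 0" if "n \<notin> ?T" for n
    using that by (auto simp: rect_count_eq)
  have "(\<Sum>\<^sub>\<infinity>n\<in>{1..}. real (rect_count m n)) = (\<Sum>\<^sub>\<infinity>n\<in>?T. real (rect_count m n))"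
    by (rule infsum_cong_neutral) (use pos zero in auto)
  also have "\<dots> = (\<Sum>n\<in>?T. real (card {l \<in> {1..m-1}. ?f l = n}))"
    by (simp add: rect_count_eq)
  also have "\<dots> = real (\<Sum>n\<in>?T. \<Sum>l | l \<in> {1..m-1} \<and> ?f l = n. 1)"
    by simp
  also have "\<dots> = real (m - 1)"
    by (subst sum.image_gen[symmetric]) auto
  finally show ?thesis .
qed

text \<open>
  The beta law, for \<open>a, b > 0\<close>. The density is set to zero at both endpoints: the convention
  \<open>0 powr 0 = 0\<close> would make it wrong there anyway, and this does not affect the measure.
\<close>

definition beta_law :: "real \<Rightarrow> real \<Rightarrow> real measure" where
  "beta_law a b = density lborel (\<lambda>x. ennreal
     (if 0 < x \<and> x < 1 then x powr (a - 1) * (1 - x) powr (b - 1) / Beta a b else 0))"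

definition limit_density :: "real \<Rightarrow> real" where
  "limit_density x = (if 0 \<le> x \<and> x < 1 then 1 / (2 * sqrt (1 - x)) else 0)"

end

theory Submission
  imports Defs "HOL-Real_Asymp.Real_Asymp"
begin

text \<open>
  With \<open>l\<close> uniform on \<open>{1..m-1}\<close>, the variable \<open>X_m\<close> has the law of \<open>4t(1 - t)\<close> at \<open>t = l/m\<close>, so
  expectations of continuous functions of \<open>X_m\<close> are Riemann sums up to an endpoint term and converge
  to \<open>\<integral>F(4t(1 - t))dt\<close> over \<open>[0,1]\<close>. With \<open>s = 2t - 1\<close> this is the integral of \<open>F(1 - s\<^sup>2)\<close> over \<open>[-1,0]\<close>,
  and \<open>1 - s\<^sup>2\<close> has the beta law for uniform \<open>s\<close>. Bounded \<open>F\<close> give weak convergence, powers give the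
  moments; the first two limits, 2/3 and 8/15, give mean and variance.
\<close>

section \<open>Riemann sums of continuous functions\<close>

text \<open>Once the mesh \<open>1/n\<close> is below the modulus of uniform continuity for
  \<open>r/2\<close>, each of the \<open>n\<close> cells contributes an error of at most
  \<open>r/2/n\<close>, so the total error is at most \<open>r/2\<close>.\<close>

lemma riemann_sum_tendsto_integral:
  fixes h :: "real \<Rightarrow> real"
  assumes h: "continuous_on {0..1} h"
  shows "(\<lambda>n::nat. (\<Sum>l=1..n. h (real l / real n)) / n) \<longlonglongrightarrow> integral {0..1} h"
proof (rule LIMSEQ_I)
  fix r :: real assume "0 < r"
  have "uniformly_continuous_on {0..1} h"
    using h by (intro compact_uniformly_continuous) auto
  then obtain d where d: "d > 0"
    "\<And>x y. x \<in> {0..1} \<Longrightarrow> y \<in> {0..1} \<Longrightarrow> dist y x < d \<Longrightarrow> dist (h y) (h x) < r / 2"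
    using \<open>0 < r\<close> unfolding uniformly_continuous_on_def by (metis half_gt_zero)
  obtain N :: nat where N: "N > 0" "1 / N < d"
    using reals_Archimedean[OF d(1)] by (auto simp: inverse_eq_divide intro: that[of "Suc _"])
  have "norm ((\<Sum>l=1..n. h (real l / real n)) / n - integral {0..1} h) < r" if "n \<ge> N" for n :: nat
  proof -
    have n: "0 < n" using N that by auto
    have "1 / real n \<le> 1 / real N"
      using N that by (intro divide_left_mono) auto
    then have nd: "1 / real n < d"
      using N by linarith
    \<comment> \<open>The mesh stays fixed while the number \<open>k\<close> of cells grows, so the
      errors add up cell by cell; \<open>k = n\<close> gives the whole interval.\<close>
    have "\<bar>integral {0..k / n} h - (\<Sum>l=1..k. h (real l / real n)) / n\<bar> \<le> k * (r / 2 / n)" if "k \<le> n" for k :: nat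
      using that
    proof (induction k)
      case 0
      then show ?case by simp
    next
      case (Suc k)
      let ?a = "real k / n" and ?b = "real (Suc k) / n"
      have ab: "0 \<le> ?a" "?a \<le> ?b" "?b \<le> 1"
        using Suc.prems n by (auto simp: divide_simps)
      have diff: "?b - ?a = 1 / n"
        by (simp add: diff_divide_distrib[symmetric])
      have int: "h integrable_on {u..v}" if "0 \<le> u" "v \<le> 1" for u v
        using that by (intro integrable_continuous_real continuous_on_subset[OF h]) auto
      \<comment> \<open>The error on one cell is the integral of the deviation of \<open>h\<close>
        from its value at the right endpoint, which uniform continuity bounds pointwise.\<close>
      have "((\<lambda>x. h x - h ?b) has_integral (integral {?a..?b} h - h ?b / n)) {?a..?b}"
        using has_integral_diff[OF integrable_integral[OF int[OF ab(1,3)]] has_integral_const_real[of "h ?b" ?a ?b]]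
          diff ab by (simp add: field_simps)
      then have "norm (integral {?a..?b} h - h ?b / n) \<le> r / 2 * measure lborel {?a..?b}"
      proof (rule has_integral_bound_real[rotated 2])
        fix x assume x: "x \<in> {?a..?b} - {}"
        then have "dist x ?b < d"
          using nd diff by (auto simp: dist_real_def)
        moreover have "0 \<le> x" "x \<le> 1"
          using order_trans[OF ab(1), of x] order_trans[OF _ ab(3), of x] x by auto
        ultimately have "dist (h x) (h ?b) < r / 2"
          using ab by (intro d(2)) auto
        then show "norm (h x - h ?b) \<le> r / 2"
          by (simp add: dist_norm)
      qed (use \<open>0 < r\<close> in auto)
      then have "\<bar>integral {?a..?b} h - h ?b / n\<bar> \<le> r / 2 / n"
        using ab diff by simp
      moreover have "integral {0..?b} h = integral {0..?a} h + integral {?a..?b} h"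
        using ab by (intro Henstock_Kurzweil_Integration.integral_combine[symmetric] int) auto
      moreover have "(\<Sum>l=1..Suc k. h (real l / real n)) / n = (\<Sum>l=1..k. h (real l / real n)) / n + h ?b / n"
        by (simp add: add_divide_distrib)
      moreover have "real (Suc k) * (r / 2 / n) = k * (r / 2 / n) + r / 2 / n"
        by (simp only: of_nat_Suc distrib_right add.commute mult_1_left)
      ultimately show ?case
        using Suc.IH Suc.prems by linarith
    qed
    from this[of n] show ?thesis
      using n \<open>0 < r\<close> by (simp add: abs_minus_commute)
  qed
  then show "\<exists>N. \<forall>n\<ge>N. norm ((\<Sum>l=1..n. h (real l / real n)) / n - integral {0..1} h) < r"
    by blast
qed

section \<open>Expectations under a law given by counting\<close>

text \<open>The hypothesis fixes only the probabilities of the values in the image of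
  \<open>f\<close>. The fibres of \<open>f\<close> partition \<open>L\<close>, so these
  probabilities sum to 1. Hence \<open>X\<close> almost surely lies in that image, and
  \<open>g (X \<omega>)\<close> is almost everywhere a finite combination of indicators.\<close>

lemma (in prob_space) expectation_finite_range:
  fixes X :: "'a \<Rightarrow> real" and f :: "'i \<Rightarrow> real" and g :: "real \<Rightarrow> real"
  assumes X [measurable]: "random_variable borel X" and g [measurable]: "g \<in> borel_measurable borel"
    and L: "finite L" "L \<noteq> {}"
    and P: "\<And>v. v \<in> f ` L \<Longrightarrow> prob {\<omega> \<in> space M. X \<omega> = v} = card {l \<in> L. f l = v} / card L"
  shows "integrable M (\<lambda>\<omega>. g (X \<omega>))"
    and "expectation (\<lambda>\<omega>. g (X \<omega>)) = (\<Sum>l\<in>L. g (f l)) / card L"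
proof -
  let ?A = "\<lambda>v. {\<omega> \<in> space M. X \<omega> = v}"
  let ?G = "\<lambda>\<omega>. \<Sum>v\<in>f ` L. g v * indicator (?A v) \<omega>"
  \<comment> \<open>Sorting \<open>L\<close> by fibres serves twice: with the constant 1 for the
    total mass, and with the given \<open>g\<close> for the expectation.\<close>
  have group: "(\<Sum>v\<in>f ` L. g v * card {l \<in> L. f l = v}) = (\<Sum>l\<in>L. g (f l))" for g :: "real \<Rightarrow> real"
    using L by (subst sum.image_gen[of L _ f]) (auto simp: mult.commute)
  have "prob (\<Union>v\<in>f ` L. ?A v) = (\<Sum>v\<in>f ` L. prob (?A v))"
    using L by (intro finite_measure_finite_Union) (auto simp: disjoint_family_on_def)
  also have "\<dots> = (\<Sum>v\<in>f ` L. 1 * card {l \<in> L. f l = v}) / card L"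
    using P by (simp add: sum_divide_distrib)
  also have "\<dots> = 1"
    using group[of "\<lambda>_. 1"] L by simp
  finally have "AE \<omega> in M. \<omega> \<in> (\<Union>v\<in>f ` L. ?A v)"
    using L by (intro AE_prob_1) auto
  then have eq: "AE \<omega> in M. g (X \<omega>) = ?G \<omega>"
  proof eventually_elim
    case (elim \<omega>)
    then have "?G \<omega> = (\<Sum>v\<in>f ` L. if v = X \<omega> then g v else 0)"
      by (intro sum.cong) (auto simp: indicator_def)
    then show ?case
      using elim L by (auto simp: sum.delta)
  qed
  have int: "integrable M (\<lambda>\<omega>. g v * indicator (?A v) \<omega>)" for v
    by (intro integrable_mult_right integrable_real_indicator) (auto simp: emeasure_eq_measure)
  have "integrable M ?G"
    using int by auto
  then show "integrable M (\<lambda>\<omega>. g (X \<omega>))"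
    using integrable_cong_AE[OF _ _ eq] by simp
  have "expectation (\<lambda>\<omega>. g (X \<omega>)) = expectation ?G"
    by (rule integral_cong_AE[OF _ _ eq]) auto
  also have "\<dots> = (\<Sum>v\<in>f ` L. g v * prob (?A v))"
    using int by (subst Bochner_Integration.integral_sum) (auto simp: Int_absorb1)
  also have "\<dots> = (\<Sum>v\<in>f ` L. g v * card {l \<in> L. f l = v}) / card L"
    using P by (simp add: sum_divide_distrib)
  also have "\<dots> = (\<Sum>l\<in>L. g (f l)) / card L"
    by (simp only: group)
  finally show "expectation (\<lambda>\<omega>. g (X \<omega>)) = (\<Sum>l\<in>L. g (f l)) / card L" .
qed

section \<open>The beta law and its integrals\<close>

text \<open>The normalising constant is \<open>Beta 1 (1/2) = 2\<close>, from Gamma(1/2) and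
  Gamma(3/2). The two densities then differ only at 0, where \<open>limit_density\<close> is 1/2 and
  the other is 0; this is a null set.\<close>

lemma beta_law_eq_density:
  "beta_law 1 (1/2) = density lborel (\<lambda>x. ennreal (limit_density x))"
proof -
  have G: "Gamma (3/2 :: real) = sqrt pi / 2"
    using Gamma_plus1[of "1/2::real"] nonpos_Ints_nonpos[of "1/2::real"] by (auto simp: Gamma_one_half_real)
  have B: "Beta 1 (1/2 :: real) = 2"
    by (simp add: Beta_def Gamma_one_half_real G)
  have *: "(if 0 < x \<and> x < 1 then x powr (1 - 1) * (1 - x) powr (1/2 - 1) / Beta 1 (1/2) else 0) = limit_density x"
    if "x \<noteq> 0" for x :: real
    using that by (auto simp: B limit_density_def powr_minus powr_half_sqrt divide_simps)
  show ?thesis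
    unfolding beta_law_def
  proof (rule density_cong)
    show "AE x in lborel. ennreal (if 0 < x \<and> x < 1 then x powr (1 - 1) * (1 - x) powr (1/2 - 1) / Beta 1 (1/2) else 0)
      = ennreal (limit_density x)"
      using AE_lborel_singleton[of "0::real"] by eventually_elim (rule arg_cong[OF *])
  qed (auto simp: limit_density_def[abs_def])
qed

text \<open>On \<open>{-1..0}\<close> the map \<open>1 - s\<^sup>2\<close> increases from 0 to 1,
  and its derivative \<open>-2 * s\<close> cancels the density
  \<open>1 / (2 * \<bar>s\<bar>)\<close>. The left half of the symmetric interval is chosen so that
  the derivative is nonnegative, as the substitution rule demands.\<close>

lemma beta_law_eq_distr:
  "beta_law 1 (1/2) = distr (restrict_space lborel {-1..0}) borel (\<lambda>s. 1 - s\<^sup>2)"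
proof (rule measure_eqI)
  fix A assume "A \<in> sets (beta_law 1 (1/2))"
  then have A [measurable]: "A \<in> sets borel" by (simp add: beta_law_def)
  have [measurable]: "limit_density \<in> borel_measurable borel"
    by (auto simp: limit_density_def[abs_def])
  let ?g = "\<lambda>s::real. 1 - s\<^sup>2"
  have "emeasure (beta_law 1 (1/2)) A = (\<integral>\<^sup>+x. ennreal (limit_density x) * indicator A x \<partial>lborel)"
    by (simp add: beta_law_eq_density emeasure_density)
  also have "\<dots> = (\<integral>\<^sup>+x. ennreal (limit_density x * indicator A x * indicator {?g (-1)..?g 0} x) \<partial>lborel)"
    by (intro nn_integral_cong) (auto simp: limit_density_def indicator_def)
  also have "\<dots> = (\<integral>\<^sup>+x. ennreal (limit_density (?g x) * indicator A (?g x) * (- 2 * x) * indicator {-1..0} x) \<partial>lborel)"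
    by (intro nn_integral_substitution) (auto intro!: derivative_eq_intros continuous_intros simp: set_borel_measurable_def)
  \<comment> \<open>The cancellation fails at \<open>x = 0\<close>, where the derivative and
    \<open>limit_density 1\<close> both vanish, so the integrands agree only almost
    everywhere.\<close>
  also have "\<dots> = (\<integral>\<^sup>+x. indicator (?g -` A \<inter> {-1..0}) x \<partial>lborel)"
    using AE_lborel_singleton[of "0::real"]
    by (intro nn_integral_cong_AE, eventually_elim)
      (auto simp: limit_density_def indicator_def abs_square_le_1 power2_le_iff_abs_le)
  also have "\<dots> = emeasure (distr (restrict_space lborel {-1..0}) borel ?g) A"
    by (subst emeasure_distr)
      (auto simp: space_restrict_space emeasure_restrict_space intro!: measurable_restrict_space1)
  finally show "emeasure (beta_law 1 (1/2)) A = emeasure (distr (restrict_space lborel {-1..0}) borel ?g) A" .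
qed (simp add: beta_law_def)

text \<open>Pulled back to the compact interval \<open>{-1..0}\<close>, the integrand is continuous
  even though the beta density blows up at 1. Unbounded \<open>F\<close> such as powers are
  covered.\<close>

lemma integral_beta_law:
  fixes F :: "real \<Rightarrow> real"
  assumes F: "continuous_on UNIV F"
  shows "integrable (beta_law 1 (1/2)) F"
    and "(LINT x|beta_law 1 (1/2). F x) = integral {-1..0} (\<lambda>s. F (1 - s\<^sup>2))"
proof -
  have [measurable]: "F \<in> borel_measurable borel"
    using F by (rule borel_measurable_continuous_onI)
  have "continuous_on {-1..0} (\<lambda>s. F (1 - s\<^sup>2))"
    by (intro continuous_on_compose2[OF F] continuous_intros) auto
  then have int: "set_integrable lborel {-1..0} (\<lambda>s. F (1 - s\<^sup>2))"
    by (rule borel_integrable_atLeastAtMost')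
  show "integrable (beta_law 1 (1/2)) F"
    unfolding beta_law_eq_distr using int
    by (subst integrable_distr_eq)
      (auto simp: integrable_restrict_space set_integrable_def intro!: measurable_restrict_space1)
  have "(LINT x|beta_law 1 (1/2). F x) = (LINT s:{-1..0}|lborel. F (1 - s\<^sup>2))"
    unfolding beta_law_eq_distr
    by (subst integral_distr)
      (auto simp: integral_restrict_space set_lebesgue_integral_def intro!: measurable_restrict_space1)
  then show "(LINT x|beta_law 1 (1/2). F x) = integral {-1..0} (\<lambda>s. F (1 - s\<^sup>2))"
    using set_borel_integral_eq_integral(2)[OF int] by simp
qed

lemma real_distribution_beta_law: "real_distribution (beta_law 1 (1/2))"
proof -
  have "prob_space (restrict_space lborel {-1..0::real})"
    by (intro prob_spaceI) (simp add: space_restrict_space emeasure_restrict_space)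
  then have "prob_space (beta_law 1 (1/2))"
    unfolding beta_law_eq_distr
    by (rule prob_space.prob_space_distr) (auto intro!: measurable_restrict_space1)
  then show ?thesis
    by (simp add: real_distribution_def real_distribution_axioms_def beta_law_def)
qed

text \<open>Since \<open>4t(1 - t) = 1 - (2t - 1)\<^sup>2\<close>, this is an affine substitution and a reflection.\<close>

lemma integral_parabola_eq_beta_law:
  fixes F :: "real \<Rightarrow> real"
  assumes F: "continuous_on UNIV F"
  shows "integral {0..1} (\<lambda>t. F (4 * t * (1 - t))) = (LINT x|beta_law 1 (1/2). F x)"
proof -
  let ?G = "\<lambda>s. F (1 - s\<^sup>2)"
  have "continuous_on S ?G" for S
    by (intro continuous_on_compose2[OF F] continuous_intros) auto
  then have int: "?G integrable_on {a..b}" for a b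
    by (rule integrable_continuous_real)
  have "integral {0..1} ?G = integral {-1..0} ?G"
    by (subst Henstock_Kurzweil_Integration.integral_reflect_real[symmetric]) simp
  then have "integral {-1..1} ?G = 2 * integral {-1..0} ?G"
    using Henstock_Kurzweil_Integration.integral_combine[where a="-1" and c=0 and b=1 and f="?G"] int by simp
  then have "(?G has_integral (2 * integral {-1..0} ?G)) (cbox (-1) 1)"
    using integrable_integral[OF int[of "-1" 1]] by simp
  \<comment> \<open>The map \<open>2 * t - 1\<close> carries \<open>{0..1}\<close> onto
    \<open>{-1..1}\<close>; its scaling factor 1/2 absorbs the factor 2 that came from
    evenness.\<close>
  from has_integral_affinity'[OF this, of 2 "-1"]
  have "((\<lambda>t. ?G (2 * t - 1)) has_integral integral {-1..0} ?G) {0..1}"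
    by simp
  moreover have "?G (2 * t - 1) = F (4 * t * (1 - t))" for t
    by (simp add: power2_eq_square algebra_simps)
  ultimately show ?thesis
    by (simp add: integral_beta_law[OF F] integral_unique)
qed

lemma integral_beta_law_id: "(LINT x|beta_law 1 (1/2). x) = 2/3"
proof -
  have "((\<lambda>s::real. 1 - s\<^sup>2) has_integral ((0 - 0^3/3) - ((-1) - (-1)^3/3))) {-1..0}"
    by (intro fundamental_theorem_of_calculus)
      (auto simp flip: has_real_derivative_iff_has_vector_derivative intro!: derivative_eq_intros)
  then show ?thesis
    by (simp add: integral_beta_law integral_unique)
qed

lemma integral_beta_law_square: "(LINT x|beta_law 1 (1/2). x\<^sup>2) = 8/15"
proof -
  have "((\<lambda>s::real. (1 - s\<^sup>2)\<^sup>2) has_integral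
      ((0 - 2 * 0^3/3 + 0^5/5) - ((-1) - 2 * (-1)^3/3 + (-1)^5/5))) {-1..0}"
    by (intro fundamental_theorem_of_calculus)
      (auto simp flip: has_real_derivative_iff_has_vector_derivative intro!: derivative_eq_intros
        simp: power2_eq_square eval_nat_numeral algebra_simps)
  then show ?thesis
    by (simp add: integral_beta_law continuous_intros integral_unique)
qed

section \<open>Averages over rectangles and the limit theorem\<close>

text \<open>The Riemann sum has the extra term \<open>l = m\<close>, equal to \<open>F 0\<close>,
  and divides by \<open>m\<close> rather than \<open>m - 1\<close>. Subtracting
  \<open>F 0 / m\<close> and multiplying by \<open>m / (m - 1)\<close> repairs both without changing
  the limit.\<close>

lemma rectangle_average_tendsto:
  fixes F :: "real \<Rightarrow> real"
  assumes F: "continuous_on UNIV F"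
  shows "(\<lambda>m. (\<Sum>l=1..m-1. F (4 * real (l * (m - l)) / real m ^ 2)) / real (m - 1))
    \<longlonglongrightarrow> (LINT x|beta_law 1 (1/2). F x)"
proof -
  let ?h = "\<lambda>t. F (4 * t * (1 - t))"
  let ?R = "\<lambda>m. (\<Sum>l=1..m. ?h (real l / real m)) / real m"
  have "continuous_on {0..1} ?h"
    by (intro continuous_on_compose2[OF F] continuous_intros) auto
  from riemann_sum_tendsto_integral[OF this] have R: "?R \<longlonglongrightarrow> (LINT x|beta_law 1 (1/2). F x)"
    unfolding integral_parabola_eq_beta_law[OF F] .
  have "(\<lambda>m. F 0 / real m) \<longlonglongrightarrow> 0"
    by real_asymp
  moreover have "(\<lambda>m. real m / (real m - 1)) \<longlonglongrightarrow> 1"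
    by real_asymp
  ultimately have "(\<lambda>m. (?R m - F 0 / real m) * (real m / (real m - 1)))
      \<longlonglongrightarrow> ((LINT x|beta_law 1 (1/2). F x) - 0) * 1"
    by (intro tendsto_intros R)
  moreover have "\<forall>\<^sub>F m in sequentially. (?R m - F 0 / real m) * (real m / (real m - 1)) =
      (\<Sum>l=1..m-1. F (4 * real (l * (m - l)) / real m ^ 2)) / real (m - 1)"
    using eventually_ge_at_top[of 2]
  proof eventually_elim
    case (elim m)
    have "(\<Sum>l=1..m. ?h (real l / real m)) = (\<Sum>l=1..m-1. ?h (real l / real m)) + F 0"
      using elim by (cases m) auto
    then have "(?R m - F 0 / real m) * (real m / (real m - 1)) = (\<Sum>l=1..m-1. ?h (real l / real m)) / real (m - 1)"
      using elim by (simp add: add_divide_distrib of_nat_diff)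
    moreover have "?h (real l / real m) = F (4 * real (l * (m - l)) / real m ^ 2)" if "l \<in> {1..m-1}" for l
    proof -
      have diff: "real (m - l) = real m - real l"
        using that elim by (intro of_nat_diff) auto
      have "4 * (real l / real m) * (1 - real l / real m) = 4 * real (l * (m - l)) / real m ^ 2"
        using diff elim by (simp add: power2_eq_square field_simps)
      then show ?thesis by simp
    qed
    ultimately show ?case by (simp only: cong: sum.cong)
  qed
  ultimately show ?thesis
    by (auto elim: Lim_transform_eventually)
qed

theorem theorem1:
  fixes M :: "nat \<Rightarrow> 'a measure" and Xt :: "nat \<Rightarrow> 'a \<Rightarrow> real"
  assumes "\<And>m. m \<ge> 2 \<Longrightarrow> prob_space (M m)"
    and "\<And>m. m \<ge> 2 \<Longrightarrow> Xt m \<in> borel_measurable (M m)"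
    and "\<And>m n. m \<ge> 2 \<Longrightarrow> n \<ge> 1 \<Longrightarrow>
           measure (M m) {\<omega> \<in> space (M m). Xt m \<omega> = real n} =
             real (rect_count m n) / (\<Sum>\<^sub>\<infinity>j\<in>{1..}. real (rect_count m j))"
  shows
    "(\<lambda>m. prob_space.expectation (M m) (Xt m)) \<sim>[at_top] (\<lambda>m. real m ^ 2 / 6) \<and>
     (\<lambda>m. prob_space.variance (M m) (Xt m)) \<sim>[at_top] (\<lambda>m. real m ^ 4 / 180) \<and>
     real_distribution (beta_law 1 (1/2)) \<and>
     beta_law 1 (1/2) = density lborel (\<lambda>x. ennreal (limit_density x)) \<and>
     weak_conv_m (\<lambda>m. distr (M m) borel (\<lambda>\<omega>. 4 * Xt m \<omega> / real m ^ 2)) (beta_law 1 (1/2)) \<and>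
     (\<forall>k::nat. integrable (beta_law 1 (1/2)) (\<lambda>x. x ^ k) \<and>
        (\<lambda>m. prob_space.expectation (M m) (\<lambda>\<omega>. (4 * Xt m \<omega> / real m ^ 2) ^ k))
          \<longlonglongrightarrow> (LINT x|beta_law 1 (1/2). x ^ k))"
proof -
  let ?f = "\<lambda>m l. real (l * (m - l))"
  let ?X = "\<lambda>m \<omega>. 4 * Xt m \<omega> / real m ^ 2"
  let ?E = "\<lambda>m. integral\<^sup>L (M m)"
  let ?\<beta> = "beta_law 1 (1/2)"
  have finite_range: "integrable (M m) (\<lambda>\<omega>. g (Xt m \<omega>))"
      "?E m (\<lambda>\<omega>. g (Xt m \<omega>)) = (\<Sum>l=1..m-1. g (?f m l)) / real (m - 1)"
    if m: "m \<ge> 2" and g: "g \<in> borel_measurable borel" for m and g :: "real \<Rightarrow> real"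
  proof -
    interpret prob_space "M m" using assms(1) m by blast
    have "prob {\<omega> \<in> space (M m). Xt m \<omega> = v} = card {l \<in> {1..m-1}. ?f m l = v} / card {1..m-1}"
      if "v \<in> ?f m ` {1..m-1}" for v
    proof -
      from that obtain l where l: "l \<in> {1..m-1}" "v = real (l * (m - l))" by blast
      \<comment> \<open>The law of \<open>Xt m\<close> is prescribed at positive integers, so the
        area must be seen to be at least 1 before the third assumption applies.\<close>
      then have "l * (m - l) \<ge> 1" using m by (auto simp: Suc_le_eq)
      then have "prob {\<omega> \<in> space (M m). Xt m \<omega> = v} = rect_count m (l * (m - l)) / real (m - 1)"
        unfolding l(2) by (subst assms(3)[OF m]) (simp_all only: rect_count_infsum)
      then show ?thesis
        unfolding rect_count_eq l(2) of_nat_eq_iff by simp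
    qed
    from expectation_finite_range[OF assms(2)[OF m] g _ _ this]
    show "integrable (M m) (\<lambda>\<omega>. g (Xt m \<omega>))"
      "?E m (\<lambda>\<omega>. g (Xt m \<omega>)) = (\<Sum>l=1..m-1. g (?f m l)) / real (m - 1)"
      using m by auto
  qed
  have lim: "(\<lambda>m. ?E m (\<lambda>\<omega>. F (?X m \<omega>))) \<longlonglongrightarrow> (LINT x|?\<beta>. F x)"
    if F: "continuous_on UNIV F" for F :: "real \<Rightarrow> real"
  proof (rule Lim_transform_eventually[OF rectangle_average_tendsto[OF F]])
    have [measurable]: "F \<in> borel_measurable borel"
      using F by (rule borel_measurable_continuous_onI)
    show "\<forall>\<^sub>F m in sequentially. (\<Sum>l=1..m-1. F (4 * ?f m l / real m ^ 2)) / real (m - 1) = ?E m (\<lambda>\<omega>. F (?X m \<omega>))"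
      using eventually_ge_at_top[of 2]
    proof eventually_elim
      case (elim m)
      show ?case
        \<comment> \<open>The normalisation by \<open>4 / m\<^sup>2\<close> is absorbed into the
          test function.\<close>
        by (rule finite_range(2)[OF elim, of "\<lambda>x. F (4 * x / real m ^ 2)", symmetric]) measurable
    qed
  qed
  have lim1: "(\<lambda>m. ?E m (?X m)) \<longlonglongrightarrow> 2/3"
    using lim[of "\<lambda>x. x"] by (simp add: integral_beta_law_id)
  have lim2: "(\<lambda>m. ?E m (\<lambda>\<omega>. (?X m \<omega>)\<^sup>2)) \<longlonglongrightarrow> 8/15"
    using lim[of "\<lambda>x. x\<^sup>2"] by (simp add: integral_beta_law_square continuous_intros)
  have "(\<lambda>m. ?E m (Xt m)) \<sim>[at_top] (\<lambda>m. real m ^ 2 / 6)"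
  proof (rule asymp_equivI')
    \<comment> \<open>Dividing by \<open>m\<^sup>2 / 6\<close> instead of
      \<open>m\<^sup>2 / 4\<close> accounts for the factor 3/2 = 6/4.\<close>
    have "(\<lambda>m. 3/2 * ?E m (?X m)) \<longlonglongrightarrow> 3/2 * (2/3)"
      by (intro tendsto_intros lim1)
    then show "(\<lambda>m. ?E m (Xt m) / (real m ^ 2 / 6)) \<longlonglongrightarrow> 1"
      by (simp add: field_simps)
  qed
  moreover have "(\<lambda>m. prob_space.variance (M m) (Xt m)) \<sim>[at_top] (\<lambda>m. real m ^ 4 / 180)"
  proof (rule asymp_equivI')
    \<comment> \<open>Here 45/4 = 180/16, since the variance of \<open>?X m\<close> is 16 / m^4
      times that of \<open>Xt m\<close>; the limiting variance is 8/15 - 4/9 = 4/45.\<close>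
    have "(\<lambda>m. 45/4 * (?E m (\<lambda>\<omega>. (?X m \<omega>)\<^sup>2) - (?E m (?X m))\<^sup>2)) \<longlonglongrightarrow> 45/4 * (8/15 - (2/3)\<^sup>2)"
      by (intro tendsto_intros lim1 lim2)
    then have "(\<lambda>m. 45/4 * (?E m (\<lambda>\<omega>. (?X m \<omega>)\<^sup>2) - (?E m (?X m))\<^sup>2)) \<longlonglongrightarrow> 1"
      by (simp add: power2_eq_square)
    then show "(\<lambda>m. prob_space.variance (M m) (Xt m) / (real m ^ 4 / 180)) \<longlonglongrightarrow> 1"
    proof (rule Lim_transform_eventually)
      show "\<forall>\<^sub>F m in sequentially. 45/4 * (?E m (\<lambda>\<omega>. (?X m \<omega>)\<^sup>2) - (?E m (?X m))\<^sup>2)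
          = prob_space.variance (M m) (Xt m) / (real m ^ 4 / 180)"
        using eventually_ge_at_top[of 2]
      proof eventually_elim
        case (elim m)
        interpret prob_space "M m" using assms(1) elim by blast
        have "variance (Xt m) = ?E m (\<lambda>\<omega>. (Xt m \<omega>)\<^sup>2) - (?E m (Xt m))\<^sup>2"
          using finite_range(1)[OF elim, of "\<lambda>x. x"] finite_range(1)[OF elim, of "\<lambda>x. x\<^sup>2"]
          by (intro variance_eq) auto
        moreover have "?E m (\<lambda>\<omega>. (?X m \<omega>)\<^sup>2) = 16 / real m ^ 4 * ?E m (\<lambda>\<omega>. (Xt m \<omega>)\<^sup>2)"
          by (simp add: power_divide power_mult_distrib flip: power_mult)
        moreover have "(?E m (?X m))\<^sup>2 = 16 / real m ^ 4 * (?E m (Xt m))\<^sup>2"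
          by (simp add: power_divide power_mult_distrib flip: power_mult)
        ultimately show ?case
          by (simp only:) (simp add: algebra_simps diff_divide_distrib)
      qed
    qed
  qed
  moreover have "weak_conv_m (\<lambda>m. distr (M m) borel (?X m)) ?\<beta>"
  proof -
    define \<mu> where "\<mu> m = distr (M m) borel (?X m)" for m
    have X [measurable]: "?X m \<in> borel_measurable (M m)" if "m \<ge> 2" for m
      using assms(2)[OF that] by measurable
    interpret real_distribution ?\<beta>
      by (rule real_distribution_beta_law)
    have dist: "real_distribution (\<mu> (m + 2))" for m
      unfolding \<mu>_def by (intro prob_space.real_distribution_distr assms(1) X) auto
    \<comment> \<open>The convergence criterion wants distributions at every index, but
      \<open>M m\<close> is known to be a probability space only from \<open>m = 2\<close> on. The
      shift is undone afterwards, pointwise on the distribution functions.\<close>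
    have "weak_conv_m (\<lambda>m. \<mu> (m + 2)) ?\<beta>"
    proof (rule integral_bdd_continuous_conv_imp_weak_conv)
      fix F :: "real \<Rightarrow> real" assume "\<And>x. isCont F x"
      then have F: "continuous_on UNIV F"
        by (simp add: continuous_at_imp_continuous_on)
      then have [measurable]: "F \<in> borel_measurable borel"
        by (rule borel_measurable_continuous_onI)
      have "integral\<^sup>L (\<mu> (m + 2)) F = ?E (m + 2) (\<lambda>\<omega>. F (?X (m + 2) \<omega>))" for m
        unfolding \<mu>_def by (rule integral_distr) (use X[of "m + 2"] in auto)
      then show "(\<lambda>m. integral\<^sup>L (\<mu> (m + 2)) F) \<longlonglongrightarrow> integral\<^sup>L ?\<beta> F"
        using LIMSEQ_ignore_initial_segment[OF lim[OF F], of 2] by simp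
    qed (rule dist real_distribution_beta_law)+
    then have "weak_conv_m \<mu> ?\<beta>"
      unfolding weak_conv_m_def weak_conv_def
      using LIMSEQ_offset[of "\<lambda>m. cdf (\<mu> m) _" 2] by blast
    then show ?thesis
      unfolding \<mu>_def .
  qed
  moreover have "integrable ?\<beta> (\<lambda>x. x ^ k) \<and> (\<lambda>m. ?E m (\<lambda>\<omega>. ?X m \<omega> ^ k)) \<longlonglongrightarrow> (LINT x|?\<beta>. x ^ k)" for k
    using integral_beta_law(1)[of "\<lambda>x. x ^ k"] lim[of "\<lambda>x. x ^ k"] by (simp add: continuous_intros)
  ultimately show ?thesis
    using real_distribution_beta_law beta_law_eq_density by blast
qed

end
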